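(* All closed substitution instances of the following equations (the axioms of standard concurrency) are derivable from the axioms of $\mathrm{ACP}^{\tau}_{\mathrm{drt}}$: $x\parallel y=y\parallel x$; $(x\parallel y)\parallel z=x\parallel(y\parallel z)$; $(x\lfloor\!\lfloor y)\lfloor\!\lfloor z=x\lfloor\!\lfloor(y\parallel z)$; $x\mid y=y\mid x$; $(x\mid y)\mid z=x\mid(y\mid z)$; $x\mid(y\lfloor\!\lfloor z)=(x\mid y)\lfloor\!\lfloor z$.
   Context: Fix a finite set $A$ of basic actions with $\tau,\delta\notin A$, and a commutative and associative function $\gamma:(A\cup\{\tau,\delta\})\times(A\cup\{\tau,\delta\})\to A\cup\{\tau,\delta\}$ with $\gamma(\tau,a)=\gamma(\delta,a)=\delta$ for all $a$. The signature of $\mathrm{ACP}^{\tau}_{\mathrm{drt}}$ consists of the constants $\underline{a}$ ($a\in A$), $\underline{\tau}$, $\underline{\delta}$; the binary operators $+$, $\cdot$, $\parallel$ (parallel composition), $\lfloor\!\lfloor$ (left merge), $\mid$ (communication merge); and the unary operators $\sigma$ (one-time-slice delay), $\partial_H$ for each $H\subseteq A$, $\tau_I$ for each $I\subseteq A$, and $\nu$ (current-time-slice time-out). In terms, $\cdot$ binds strongest and $+$ weakest. A closed substitution instance of an equation is obtained by replacing its variables by closed $\mathrm{ACP}^{\tau}_{\mathrm{drt}}$ terms. The axioms of $\mathrm{ACP}^{\tau}_{\mathrm{drt}}$ are the following equations, where $a,b,c$ range over $A\cup\{\tau,\delta\}$ and $H,I\subseteq A$: $x+y=y+x$; $(x+y)+z=x+(y+z)$;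 $x+x=x$; $(x+y)\cdot z=x\cdot z+y\cdot z$; $(x\cdot y)\cdot z=x\cdot(y\cdot z)$; $x+\underline{\delta}=x$; $\underline{\delta}\cdot x=\underline{\delta}$; $\sigma(x)+\sigma(y)=\sigma(x+y)$; $\sigma(x)\cdot y=\sigma(x\cdot y)$; $\partial_H(\underline a)=\underline a$ if $a\notin H$; $\partial_H(\underline a)=\underline\delta$ if $a\in H$; $\partial_H(x+y)=\partial_H(x)+\partial_H(y)$; $\partial_H(x\cdot y)=\partial_H(x)\cdot\partial_H(y)$; $\partial_H(\sigma(x))=\sigma(\partial_H(x))$; $\tau_I(\underline a)=\underline a$ if $a\notin I$; $\tau_I(\underline a)=\underline\tau$ if $a\in I$; $\tau_I(x+y)=\tau_I(x)+\tau_I(y)$; $\tau_I(x\cdot y)=\tau_I(x)\cdot\tau_I(y)$; $\tau_I(\sigma(x))=\sigma(\tau_I(x))$; $x\parallel y=(x\lfloor\!\lfloor y+y\lfloor\!\lfloor x)+x\mid y$; $\underline a\lfloor\!\lfloor x=\underline a\cdot x$; $\underline a\cdot x\lfloor\!\lfloor y=\underline a\cdot(x\parallel y)$; $\sigma(x)\lfloor\!\lfloor\nu(y)=\underline\delta$; $\sigma(x)\lfloor\!\lfloor(\nu(y)+\sigma(z))=\sigma(x\lfloor\!\lfloor z)$; $(x+y)\lfloor\!\lfloor z=x\lfloor\!\lfloor z+y\lfloor\!\lfloor z$; $\underline a\cdot x\mid\underline b=(\underline a\mid\underline b)\cdot x$; $\underline a\mid\underline b\cdot x=(\underline a\mid\underline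 b)\cdot x$; $\underline a\cdot x\mid\underline b\cdot y=(\underline a\mid\underline b)\cdot(x\parallel y)$; $\nu(x)\mid\sigma(y)=\underline\delta$; $\sigma(x)\mid\nu(y)=\underline\delta$; $\sigma(x)\mid\sigma(y)=\sigma(x\mid y)$; $(x+y)\mid z=x\mid z+y\mid z$; $x\mid(y+z)=x\mid y+x\mid z$; $\underline a\mid\underline b=\underline c$ if $\gamma(a,b)=c$; $\nu(\underline a)=\underline a$; $\nu(x+y)=\nu(x)+\nu(y)$; $\nu(x\cdot y)=\nu(x)\cdot y$; $\nu(\sigma(x))=\underline\delta$; $\underline a\cdot\underline\tau=\underline a$; $\underline a\cdot(\underline\tau\cdot(\nu(x)+y)+\nu(x))=\underline a\cdot(\nu(x)+y)$; $\underline a\cdot(\underline\tau\cdot(\nu(x)+y)+y)=\underline a\cdot(\nu(x)+y)$; $\underline a\cdot(\sigma(\underline\tau\cdot x)+\nu(y))=\underline a\cdot(\sigma(x)+\nu(y))$. *)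

theory Defs
  imports Main
begin

datatype 'a act = Act 'a | Tau | Delta

definition actions :: "'a set \<Rightarrow> 'a act set" where
  "actions A = Act ` A \<union> {Tau, Delta}"

text \<open>
  The type of raw terms does not know the set \<open>A\<close> of basic actions;
  membership in the signature over \<open>A\<close> is the predicate \<open>wf_term\<close> below.
  The delimiter \<open>\<^bold>\<lfloor>\<close> is left merge and \<open>\<^bold>|\<close> is communication merge.
\<close>

datatype 'a tm =
    Var nat
  | Const "'a act"
  | Alt "'a tm" "'a tm"     (infixl \<open>\<^bold>+\<close> 65)
  | Seq "'a tm" "'a tm"     (infixl \<open>\<^bold>\<cdot>\<close> 75)
  | Par "'a tm" "'a tm"     (infixl \<open>\<^bold>\<parallel>\<close> 70)
  | LMerge "'a tm" "'a tm"  (infixl \<open>\<^bold>\<lfloor>\<close> 70)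
  | CMerge "'a tm" "'a tm"  (infixl \<open>\<^bold>|\<close> 70)
  | Delay "'a tm"
  | Encap "'a set" "'a tm"
  | Hide "'a set" "'a tm"
  | Timeout "'a tm"

primrec vars :: "'a tm \<Rightarrow> nat set" where
  "vars (Var v) = {v}"
| "vars (Const a) = {}"
| "vars (s \<^bold>+ t) = vars s \<union> vars t"
| "vars (s \<^bold>\<cdot> t) = vars s \<union> vars t"
| "vars (s \<^bold>\<parallel> t) = vars s \<union> vars t"
| "vars (s \<^bold>\<lfloor> t) = vars s \<union> vars t"
| "vars (s \<^bold>| t) = vars s \<union> vars t"
| "vars (Delay t) = vars t"
| "vars (Encap H t) = vars t"
| "vars (Hide I t) = vars t"
| "vars (Timeout t) = vars t"

primrec wf_term :: "'a set \<Rightarrow> 'a tm \<Rightarrow> bool" where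
  "wf_term A (Var v) \<longleftrightarrow> True"
| "wf_term A (Const a) \<longleftrightarrow> a \<in> actions A"
| "wf_term A (s \<^bold>+ t) \<longleftrightarrow> wf_term A s \<and> wf_term A t"
| "wf_term A (s \<^bold>\<cdot> t) \<longleftrightarrow> wf_term A s \<and> wf_term A t"
| "wf_term A (s \<^bold>\<parallel> t) \<longleftrightarrow> wf_term A s \<and> wf_term A t"
| "wf_term A (s \<^bold>\<lfloor> t) \<longleftrightarrow> wf_term A s \<and> wf_term A t"
| "wf_term A (s \<^bold>| t) \<longleftrightarrow> wf_term A s \<and> wf_term A t"
| "wf_term A (Delay t) \<longleftrightarrow> wf_term A t"
| "wf_term A (Encap H t) \<longleftrightarrow> H \<subseteq> A \<and> wf_term A t"
| "wf_term A (Hide I t) \<longleftrightarrow> I \<subseteq> A \<and> wf_term A t"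
| "wf_term A (Timeout t) \<longleftrightarrow> wf_term A t"

definition closed_term :: "'a set \<Rightarrow> 'a tm \<Rightarrow> bool" where
  "closed_term A t \<longleftrightarrow> wf_term A t \<and> vars t = {}"

primrec subst :: "(nat \<Rightarrow> 'a tm) \<Rightarrow> 'a tm \<Rightarrow> 'a tm" where
  "subst \<rho> (Var v) = \<rho> v"
| "subst \<rho> (Const a) = Const a"
| "subst \<rho> (s \<^bold>+ t) = subst \<rho> s \<^bold>+ subst \<rho> t"
| "subst \<rho> (s \<^bold>\<cdot> t) = subst \<rho> s \<^bold>\<cdot> subst \<rho> t"
| "subst \<rho> (s \<^bold>\<parallel> t) = subst \<rho> s \<^bold>\<parallel> subst \<rho> t"
| "subst \<rho> (s \<^bold>\<lfloor> t) = subst \<rho> s \<^bold>\<lfloor> subst \<rho> t"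
| "subst \<rho> (s \<^bold>| t) = subst \<rho> s \<^bold>| subst \<rho> t"
| "subst \<rho> (Delay t) = Delay (subst \<rho> t)"
| "subst \<rho> (Encap H t) = Encap H (subst \<rho> t)"
| "subst \<rho> (Hide I t) = Hide I (subst \<rho> t)"
| "subst \<rho> (Timeout t) = Timeout (subst \<rho> t)"

abbreviation vx :: "'a tm" where "vx \<equiv> Var 0"
abbreviation vy :: "'a tm" where "vy \<equiv> Var 1"
abbreviation vz :: "'a tm" where "vz \<equiv> Var 2"

inductive_set axioms :: "'a set \<Rightarrow> ('a act \<Rightarrow> 'a act \<Rightarrow> 'a act) \<Rightarrow> ('a tm \<times> 'a tm) set"
  for A :: "'a set" and \<gamma> :: "'a act \<Rightarrow> 'a act \<Rightarrow> 'a act" where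
  alt_comm: "(vx \<^bold>+ vy, vy \<^bold>+ vx) \<in> axioms A \<gamma>"
| alt_assoc: "((vx \<^bold>+ vy) \<^bold>+ vz, vx \<^bold>+ (vy \<^bold>+ vz)) \<in> axioms A \<gamma>"
| alt_idem: "(vx \<^bold>+ vx, vx) \<in> axioms A \<gamma>"
| seq_distrib: "((vx \<^bold>+ vy) \<^bold>\<cdot> vz, vx \<^bold>\<cdot> vz \<^bold>+ vy \<^bold>\<cdot> vz) \<in> axioms A \<gamma>"
| seq_assoc: "((vx \<^bold>\<cdot> vy) \<^bold>\<cdot> vz, vx \<^bold>\<cdot> (vy \<^bold>\<cdot> vz)) \<in> axioms A \<gamma>"
| alt_delta: "(vx \<^bold>+ Const Delta, vx) \<in> axioms A \<gamma>"
| delta_seq: "(Const Delta \<^bold>\<cdot> vx, Const Delta) \<in> axioms A \<gamma>"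

| delay_alt: "(Delay vx \<^bold>+ Delay vy, Delay (vx \<^bold>+ vy)) \<in> axioms A \<gamma>"
| delay_seq: "(Delay vx \<^bold>\<cdot> vy, Delay (vx \<^bold>\<cdot> vy)) \<in> axioms A \<gamma>"

| encap_notin: "a \<in> actions A \<Longrightarrow> H \<subseteq> A \<Longrightarrow> a \<notin> Act ` H \<Longrightarrow>
    (Encap H (Const a), Const a) \<in> axioms A \<gamma>"
| encap_in: "a \<in> actions A \<Longrightarrow> H \<subseteq> A \<Longrightarrow> a \<in> Act ` H \<Longrightarrow>
    (Encap H (Const a), Const Delta) \<in> axioms A \<gamma>"
| encap_alt: "H \<subseteq> A \<Longrightarrow>
    (Encap H (vx \<^bold>+ vy), Encap H vx \<^bold>+ Encap H vy) \<in> axioms A \<gamma>"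
| encap_seq: "H \<subseteq> A \<Longrightarrow>
    (Encap H (vx \<^bold>\<cdot> vy), Encap H vx \<^bold>\<cdot> Encap H vy) \<in> axioms A \<gamma>"
| encap_delay: "H \<subseteq> A \<Longrightarrow>
    (Encap H (Delay vx), Delay (Encap H vx)) \<in> axioms A \<gamma>"

| hide_notin: "a \<in> actions A \<Longrightarrow> I \<subseteq> A \<Longrightarrow> a \<notin> Act ` I \<Longrightarrow>
    (Hide I (Const a), Const a) \<in> axioms A \<gamma>"
| hide_in: "a \<in> actions A \<Longrightarrow> I \<subseteq> A \<Longrightarrow> a \<in> Act ` I \<Longrightarrow>
    (Hide I (Const a), Const Tau) \<in> axioms A \<gamma>"
| hide_alt: "I \<subseteq> A \<Longrightarrow>
    (Hide I (vx \<^bold>+ vy), Hide I vx \<^bold>+ Hide I vy) \<in> axioms A \<gamma>"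
| hide_seq: "I \<subseteq> A \<Longrightarrow>
    (Hide I (vx \<^bold>\<cdot> vy), Hide I vx \<^bold>\<cdot> Hide I vy) \<in> axioms A \<gamma>"
| hide_delay: "I \<subseteq> A \<Longrightarrow>
    (Hide I (Delay vx), Delay (Hide I vx)) \<in> axioms A \<gamma>"

| par: "(vx \<^bold>\<parallel> vy, (vx \<^bold>\<lfloor> vy \<^bold>+ vy \<^bold>\<lfloor> vx) \<^bold>+ vx \<^bold>| vy) \<in> axioms A \<gamma>"
| lmerge_const: "a \<in> actions A \<Longrightarrow>
    (Const a \<^bold>\<lfloor> vx, Const a \<^bold>\<cdot> vx) \<in> axioms A \<gamma>"
| lmerge_prefix: "a \<in> actions A \<Longrightarrow>
    ((Const a \<^bold>\<cdot> vx) \<^bold>\<lfloor> vy, Const a \<^bold>\<cdot> (vx \<^bold>\<parallel> vy)) \<in> axioms A \<gamma>"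
| lmerge_delay_timeout: "(Delay vx \<^bold>\<lfloor> Timeout vy, Const Delta) \<in> axioms A \<gamma>"
| lmerge_delay_delay:
    "(Delay vx \<^bold>\<lfloor> (Timeout vy \<^bold>+ Delay vz), Delay (vx \<^bold>\<lfloor> vz)) \<in> axioms A \<gamma>"
| lmerge_alt: "((vx \<^bold>+ vy) \<^bold>\<lfloor> vz, vx \<^bold>\<lfloor> vz \<^bold>+ vy \<^bold>\<lfloor> vz) \<in> axioms A \<gamma>"
| cmerge_prefix_const: "a \<in> actions A \<Longrightarrow> b \<in> actions A \<Longrightarrow>
    ((Const a \<^bold>\<cdot> vx) \<^bold>| Const b, (Const a \<^bold>| Const b) \<^bold>\<cdot> vx) \<in> axioms A \<gamma>"
| cmerge_const_prefix: "a \<in> actions A \<Longrightarrow> b \<in> actions A \<Longrightarrow>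
    (Const a \<^bold>| (Const b \<^bold>\<cdot> vx), (Const a \<^bold>| Const b) \<^bold>\<cdot> vx) \<in> axioms A \<gamma>"
| cmerge_prefix_prefix: "a \<in> actions A \<Longrightarrow> b \<in> actions A \<Longrightarrow>
    ((Const a \<^bold>\<cdot> vx) \<^bold>| (Const b \<^bold>\<cdot> vy), (Const a \<^bold>| Const b) \<^bold>\<cdot> (vx \<^bold>\<parallel> vy)) \<in> axioms A \<gamma>"
| cmerge_timeout_delay: "(Timeout vx \<^bold>| Delay vy, Const Delta) \<in> axioms A \<gamma>"
| cmerge_delay_timeout: "(Delay vx \<^bold>| Timeout vy, Const Delta) \<in> axioms A \<gamma>"
| cmerge_delay_delay: "(Delay vx \<^bold>| Delay vy, Delay (vx \<^bold>| vy)) \<in> axioms A \<gamma>"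
| cmerge_alt_left: "((vx \<^bold>+ vy) \<^bold>| vz, vx \<^bold>| vz \<^bold>+ vy \<^bold>| vz) \<in> axioms A \<gamma>"
| cmerge_alt_right: "(vx \<^bold>| (vy \<^bold>+ vz), vx \<^bold>| vy \<^bold>+ vx \<^bold>| vz) \<in> axioms A \<gamma>"
| cmerge_const: "a \<in> actions A \<Longrightarrow> b \<in> actions A \<Longrightarrow> c \<in> actions A \<Longrightarrow> \<gamma> a b = c \<Longrightarrow>
    (Const a \<^bold>| Const b, Const c) \<in> axioms A \<gamma>"

| timeout_const: "a \<in> actions A \<Longrightarrow> (Timeout (Const a), Const a) \<in> axioms A \<gamma>"
| timeout_alt: "(Timeout (vx \<^bold>+ vy), Timeout vx \<^bold>+ Timeout vy) \<in> axioms A \<gamma>"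
| timeout_seq: "(Timeout (vx \<^bold>\<cdot> vy), Timeout vx \<^bold>\<cdot> vy) \<in> axioms A \<gamma>"
| timeout_delay: "(Timeout (Delay vx), Const Delta) \<in> axioms A \<gamma>"

| tau1: "a \<in> actions A \<Longrightarrow> (Const a \<^bold>\<cdot> Const Tau, Const a) \<in> axioms A \<gamma>"
| tau2: "a \<in> actions A \<Longrightarrow>
    (Const a \<^bold>\<cdot> (Const Tau \<^bold>\<cdot> (Timeout vx \<^bold>+ vy) \<^bold>+ Timeout vx),
     Const a \<^bold>\<cdot> (Timeout vx \<^bold>+ vy)) \<in> axioms A \<gamma>"
| tau3: "a \<in> actions A \<Longrightarrow>
    (Const a \<^bold>\<cdot> (Const Tau \<^bold>\<cdot> (Timeout vx \<^bold>+ vy) \<^bold>+ vy),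
     Const a \<^bold>\<cdot> (Timeout vx \<^bold>+ vy)) \<in> axioms A \<gamma>"
| tau4: "a \<in> actions A \<Longrightarrow>
    (Const a \<^bold>\<cdot> (Delay (Const Tau \<^bold>\<cdot> vx) \<^bold>+ Timeout vy),
     Const a \<^bold>\<cdot> (Delay vx \<^bold>+ Timeout vy)) \<in> axioms A \<gamma>"

text \<open>
  Equational logic over the terms of the signature: every term occurring in a derivation
  is well-formed over \<open>A\<close>.
\<close>

inductive derivable ::
  "'a set \<Rightarrow> ('a act \<Rightarrow> 'a act \<Rightarrow> 'a act) \<Rightarrow> 'a tm \<Rightarrow> 'a tm \<Rightarrow> bool"
  for A :: "'a set" and \<gamma> :: "'a act \<Rightarrow> 'a act \<Rightarrow> 'a act" where
  ax: "(s, t) \<in> axioms A \<gamma> \<Longrightarrow> (\<And>v. wf_term A (\<rho> v)) \<Longrightarrow>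
    derivable A \<gamma> (subst \<rho> s) (subst \<rho> t)"
| refl: "wf_term A t \<Longrightarrow> derivable A \<gamma> t t"
| sym: "derivable A \<gamma> s t \<Longrightarrow> derivable A \<gamma> t s"
| trans: "derivable A \<gamma> s t \<Longrightarrow> derivable A \<gamma> t u \<Longrightarrow> derivable A \<gamma> s u"
| cong_alt: "derivable A \<gamma> s s' \<Longrightarrow> derivable A \<gamma> t t' \<Longrightarrow> derivable A \<gamma> (s \<^bold>+ t) (s' \<^bold>+ t')"
| cong_seq: "derivable A \<gamma> s s' \<Longrightarrow> derivable A \<gamma> t t' \<Longrightarrow> derivable A \<gamma> (s \<^bold>\<cdot> t) (s' \<^bold>\<cdot> t')"
| cong_par: "derivable A \<gamma> s s' \<Longrightarrow> derivable A \<gamma> t t' \<Longrightarrow> derivable A \<gamma> (s \<^bold>\<parallel> t) (s' \<^bold>\<parallel> t')"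
| cong_lmerge: "derivable A \<gamma> s s' \<Longrightarrow> derivable A \<gamma> t t' \<Longrightarrow> derivable A \<gamma> (s \<^bold>\<lfloor> t) (s' \<^bold>\<lfloor> t')"
| cong_cmerge: "derivable A \<gamma> s s' \<Longrightarrow> derivable A \<gamma> t t' \<Longrightarrow> derivable A \<gamma> (s \<^bold>| t) (s' \<^bold>| t')"
| cong_delay: "derivable A \<gamma> s t \<Longrightarrow> derivable A \<gamma> (Delay s) (Delay t)"
| cong_encap: "H \<subseteq> A \<Longrightarrow> derivable A \<gamma> s t \<Longrightarrow> derivable A \<gamma> (Encap H s) (Encap H t)"
| cong_hide: "I \<subseteq> A \<Longrightarrow> derivable A \<gamma> s t \<Longrightarrow> derivable A \<gamma> (Hide I s) (Hide I t)"
| cong_timeout: "derivable A \<gamma> s t \<Longrightarrow> derivable A \<gamma> (Timeout s) (Timeout t)"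

definition standard_concurrency :: "('a tm \<times> 'a tm) set" where
  "standard_concurrency =
    {(vx \<^bold>\<parallel> vy, vy \<^bold>\<parallel> vx),
     ((vx \<^bold>\<parallel> vy) \<^bold>\<parallel> vz, vx \<^bold>\<parallel> (vy \<^bold>\<parallel> vz)),
     ((vx \<^bold>\<lfloor> vy) \<^bold>\<lfloor> vz, vx \<^bold>\<lfloor> (vy \<^bold>\<parallel> vz)),
     (vx \<^bold>| vy, vy \<^bold>| vx),
     ((vx \<^bold>| vy) \<^bold>| vz, vx \<^bold>| (vy \<^bold>| vz)),
     (vx \<^bold>| (vy \<^bold>\<lfloor> vz), (vx \<^bold>| vy) \<^bold>\<lfloor> vz)}"

end

theory Submission
  imports Defs
begin

text \<open>
  Every closed term is provably equal to a basic term, a finite sum of terms \<open>a\<close>, \<open>a \<cdot> p\<close> and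
  \<open>\<sigma>(p)\<close> with \<open>p\<close> basic, and every basic term \<open>y\<close> satisfies \<open>y = \<nu>(y)\<close> or
  \<open>y = \<nu>(y) + \<sigma>(y')\<close> for a basic term \<open>y'\<close> of smaller depth. For basic terms the two
  commutativity laws follow by induction on the sum of the two depths. The four laws in
  three variables follow by a simultaneous induction on the sum of the three depths: the laws for
  \<open>\<lfloor>\<close> and \<open>|\<close> need associativity of \<open>\<parallel>\<close> only for smaller sums, and they imply it for the
  same sum by expanding both sides.

  Derivable equality is turned into equality by choosing a representative \<open>rep t\<close> of the
  provable-equality class of \<open>t\<close>; the operations \<open>\<oplus>\<close>, \<open>\<odot>\<close>, \<open>\<parallel>\<close>, \<open>\<lfloor>\<close>, \<open>\<bowtie>\<close> (the last one being
  communication merge) then satisfy the axioms as equations of HOL.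
\<close>

section \<open>Representatives modulo derivable equality\<close>

text \<open>Making every raw term well-formed spares side conditions in the laws below.\<close>

primrec restrict_term :: "'a set \<Rightarrow> 'a tm \<Rightarrow> 'a tm" where
  "restrict_term A (Var v) = Var v"
| "restrict_term A (Const a) = Const (if a \<in> actions A then a else Delta)"
| "restrict_term A (s \<^bold>+ t) = restrict_term A s \<^bold>+ restrict_term A t"
| "restrict_term A (s \<^bold>\<cdot> t) = restrict_term A s \<^bold>\<cdot> restrict_term A t"
| "restrict_term A (s \<^bold>\<parallel> t) = restrict_term A s \<^bold>\<parallel> restrict_term A t"
| "restrict_term A (s \<^bold>\<lfloor> t) = restrict_term A s \<^bold>\<lfloor> restrict_term A t"
| "restrict_term A (s \<^bold>| t) = restrict_term A s \<^bold>| restrict_term A t"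
| "restrict_term A (Delay t) = Delay (restrict_term A t)"
| "restrict_term A (Encap H t) = Encap (H \<inter> A) (restrict_term A t)"
| "restrict_term A (Hide I t) = Hide (I \<inter> A) (restrict_term A t)"
| "restrict_term A (Timeout t) = Timeout (restrict_term A t)"

lemma Tau_Delta_in_actions [simp]: "Tau \<in> actions A" "Delta \<in> actions A"
  by (auto simp: actions_def)

lemma wf_restrict_term [simp]: "wf_term A (restrict_term A t)"
  by (induction t) auto

lemma restrict_term_wf: "wf_term A t \<Longrightarrow> restrict_term A t = t"
  by (induction t) (auto simp: Int_absorb2)

lemma restrict_term_subst:
  "wf_term A t \<Longrightarrow> restrict_term A (subst \<rho> t) = subst (restrict_term A \<circ> \<rho>) t"
  by (induction t) (auto simp: Int_absorb2)

lemma wf_subst: "wf_term A t \<Longrightarrow> (\<And>v. wf_term A (\<rho> v)) \<Longrightarrow> wf_term A (subst \<rho> t)"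
  by (induction t) auto

lemma wf_axioms: "(s, t) \<in> axioms A \<gamma> \<Longrightarrow> wf_term A s \<and> wf_term A t"
  by (cases rule: axioms.cases) auto

lemma wf_derivable: "derivable A \<gamma> s t \<Longrightarrow> wf_term A s \<and> wf_term A t"
  by (induction rule: derivable.induct) (auto dest: wf_axioms intro: wf_subst)

locale communication =
  fixes A :: "'a set" and \<gamma> :: "'a act \<Rightarrow> 'a act \<Rightarrow> 'a act"
  assumes comm_closed [simp]: "a \<in> actions A \<Longrightarrow> b \<in> actions A \<Longrightarrow> \<gamma> a b \<in> actions A"
    and comm_commute: "a \<in> actions A \<Longrightarrow> b \<in> actions A \<Longrightarrow> \<gamma> a b = \<gamma> b a"
    and comm_assoc: "a \<in> actions A \<Longrightarrow> b \<in> actions A \<Longrightarrow> c \<in> actions A \<Longrightarrow>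
      \<gamma> (\<gamma> a b) c = \<gamma> a (\<gamma> b c)"
    and comm_Delta: "a \<in> actions A \<Longrightarrow> \<gamma> Delta a = Delta"
begin

definition rep :: "'a tm \<Rightarrow> 'a tm" where
  "rep t = (SOME s. derivable A \<gamma> (restrict_term A t) s)"

lemma derivable_rep: "derivable A \<gamma> (restrict_term A t) (rep t)"
  unfolding rep_def by (rule someI[of _ "restrict_term A t"]) (simp add: derivable.refl)

lemma restrict_term_rep [simp]: "restrict_term A (rep t) = rep t"
  using derivable_rep[of t] wf_derivable restrict_term_wf by blast

text \<open>Provably equal terms determine the same predicate \<open>derivable A \<gamma> _\<close>,
  and the choice operator depends on that predicate only.\<close>

lemma rep_eqI: "derivable A \<gamma> (restrict_term A s) (restrict_term A t) \<Longrightarrow> rep s = rep t"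
proof -
  assume "derivable A \<gamma> (restrict_term A s) (restrict_term A t)"
  then have "derivable A \<gamma> (restrict_term A s) = derivable A \<gamma> (restrict_term A t)"
    by (blast intro: derivable.sym derivable.trans)
  then show ?thesis by (simp add: rep_def)
qed

text \<open>The way back from HOL equality to derivability. Well-formedness matters here, because
  \<open>rep\<close> identifies a raw term with its restriction.\<close>

lemma rep_eqD: "rep s = rep t \<Longrightarrow> wf_term A s \<Longrightarrow> wf_term A t \<Longrightarrow> derivable A \<gamma> s t"
  using derivable_rep[of s] derivable_rep[of t]
  by (metis derivable.sym derivable.trans restrict_term_wf)

lemma rep_rep [simp]: "rep (rep t) = rep t"
  by (rule rep_eqI) (simp add: derivable.sym derivable_rep)

text \<open>Restriction leaves the two sides of an axiom alone and passes to the substituted terms,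
  so \<open>\<rho>\<close> may be arbitrary.\<close>

lemma rep_axiom: "(s, t) \<in> axioms A \<gamma> \<Longrightarrow> rep (subst \<rho> s) = rep (subst \<rho> t)"
  using wf_axioms[of s t A \<gamma>]
  by (intro rep_eqI) (auto simp: restrict_term_subst intro!: derivable.ax)

section \<open>The operators of the signature acting on representatives\<close>

definition cst :: "'a act \<Rightarrow> 'a tm" where "cst a = rep (Const a)"
definition alt (infixl "\<oplus>" 65) where "x \<oplus> y = rep (x \<^bold>+ y)"
definition seq (infixl "\<odot>" 75) where "x \<odot> y = rep (x \<^bold>\<cdot> y)"
definition par (infixl "\<parallel>" 70) where "x \<parallel> y = rep (x \<^bold>\<parallel> y)"
definition lm (infixl "\<lfloor>" 70) where "x \<lfloor> y = rep (x \<^bold>\<lfloor> y)"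
definition cm (infixl "\<bowtie>" 70) where "x \<bowtie> y = rep (x \<^bold>| y)"
definition dly :: "'a tm \<Rightarrow> 'a tm" where "dly x = rep (Delay x)"
definition enc :: "'a set \<Rightarrow> 'a tm \<Rightarrow> 'a tm" where "enc H x = rep (Encap H x)"
definition hid :: "'a set \<Rightarrow> 'a tm \<Rightarrow> 'a tm" where "hid I x = rep (Hide I x)"
definition tmo :: "'a tm \<Rightarrow> 'a tm" where "tmo x = rep (Timeout x)"

lemmas op_defs = cst_def alt_def seq_def par_def lm_def cm_def dly_def enc_def hid_def tmo_def

lemma rep_op [simp]:
  "rep (cst a) = cst a" "rep (x \<oplus> y) = x \<oplus> y" "rep (x \<odot> y) = x \<odot> y"
  "rep (x \<parallel> y) = x \<parallel> y" "rep (x \<lfloor> y) = x \<lfloor> y" "rep (x \<bowtie> y) = x \<bowtie> y"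
  "rep (dly x) = dly x" "rep (enc H x) = enc H x" "rep (hid H x) = hid H x" "rep (tmo x) = tmo x"
  by (simp_all add: op_defs)

text \<open>Provable equality is a congruence, so an argument may be replaced by its representative;
  this makes \<open>rep\<close> a homomorphism in \<open>rep_hom\<close>.\<close>

lemma op_rep [simp]:
  "rep x \<oplus> y = x \<oplus> y" "x \<oplus> rep y = x \<oplus> y" "rep x \<odot> y = x \<odot> y" "x \<odot> rep y = x \<odot> y"
  "rep x \<parallel> y = x \<parallel> y" "x \<parallel> rep y = x \<parallel> y" "rep x \<lfloor> y = x \<lfloor> y" "x \<lfloor> rep y = x \<lfloor> y"
  "rep x \<bowtie> y = x \<bowtie> y" "x \<bowtie> rep y = x \<bowtie> y"
  "dly (rep x) = dly x" "enc H (rep x) = enc H x" "hid H (rep x) = hid H x" "tmo (rep x) = tmo x"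
  unfolding op_defs
  \<comment> \<open>Rules 5 to 13 of \<open>derivable\<close> are the congruence rules.\<close>
  by (auto intro!: rep_eqI derivable.intros(5-13)
      intro: derivable.sym[OF derivable_rep] derivable.refl[OF wf_restrict_term])

lemma rep_hom:
  "rep (Const a) = cst a" "rep (s \<^bold>+ t) = rep s \<oplus> rep t" "rep (s \<^bold>\<cdot> t) = rep s \<odot> rep t"
  "rep (s \<^bold>\<parallel> t) = rep s \<parallel> rep t" "rep (s \<^bold>\<lfloor> t) = rep s \<lfloor> rep t" "rep (s \<^bold>| t) = rep s \<bowtie> rep t"
  "rep (Delay s) = dly (rep s)" "rep (Encap H s) = enc H (rep s)"
  "rep (Hide H s) = hid H (rep s)" "rep (Timeout s) = tmo (rep s)"
  by (simp_all add: op_defs[symmetric])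

abbreviation dd :: "'a tm" where "dd \<equiv> cst Delta"

section \<open>The axioms as equations of HOL\<close>

lemmas rep_axiom3 = rep_axiom[where \<rho> = "\<lambda>v. if v = 0 then x else if v = 1 then y else z" for x y z]

text \<open>Arguments range over all raw terms, not only over representatives; hence
  \<open>rep x\<close> stands where a side of an axiom is a bare variable.\<close>

lemma alt_comm: "x \<oplus> y = y \<oplus> x"
  and alt_assoc: "x \<oplus> y \<oplus> z = x \<oplus> (y \<oplus> z)"
  and alt_idem [simp]: "x \<oplus> x = rep x"
  and seq_distrib: "(x \<oplus> y) \<odot> z = x \<odot> z \<oplus> y \<odot> z"
  and seq_assoc: "x \<odot> y \<odot> z = x \<odot> (y \<odot> z)"
  and alt_delta [simp]: "x \<oplus> dd = rep x"
  and delta_seq [simp]: "dd \<odot> x = dd"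
  and delay_alt: "dly x \<oplus> dly y = dly (x \<oplus> y)"
  and delay_seq: "dly x \<odot> y = dly (x \<odot> y)"
  and par_expand: "x \<parallel> y = x \<lfloor> y \<oplus> y \<lfloor> x \<oplus> x \<bowtie> y"
  and lm_delay_timeout: "dly x \<lfloor> tmo y = dd"
  and lm_delay_delay: "dly x \<lfloor> (tmo y \<oplus> dly z) = dly (x \<lfloor> z)"
  and lm_alt: "(x \<oplus> y) \<lfloor> z = x \<lfloor> z \<oplus> y \<lfloor> z"
  and cm_timeout_delay: "tmo x \<bowtie> dly y = dd"
  and cm_delay_timeout: "dly x \<bowtie> tmo y = dd"
  and cm_delay_delay: "dly x \<bowtie> dly y = dly (x \<bowtie> y)"
  and cm_alt_left: "(x \<oplus> y) \<bowtie> z = x \<bowtie> z \<oplus> y \<bowtie> z"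
  and cm_alt_right: "x \<bowtie> (y \<oplus> z) = x \<bowtie> y \<oplus> x \<bowtie> z"
  and tmo_alt: "tmo (x \<oplus> y) = tmo x \<oplus> tmo y"
  and tmo_seq: "tmo (x \<odot> y) = tmo x \<odot> y"
  and tmo_delay: "tmo (dly x) = dd"
  using axioms.intros(1-9)[of A \<gamma>, THEN rep_axiom3, of x y z] axioms.par[THEN rep_axiom3, of x y z]
    axioms.lmerge_delay_timeout[THEN rep_axiom3, of x y z]
    axioms.lmerge_delay_delay[THEN rep_axiom3, of x y z] axioms.lmerge_alt[THEN rep_axiom3, of x y z]
    axioms.cmerge_timeout_delay[THEN rep_axiom3, of x y z]
    axioms.cmerge_delay_timeout[THEN rep_axiom3, of x y z]
    axioms.cmerge_delay_delay[THEN rep_axiom3, of x y z]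
    axioms.cmerge_alt_left[THEN rep_axiom3, of x y z]
    axioms.cmerge_alt_right[THEN rep_axiom3, of x y z]
    axioms.timeout_alt[THEN rep_axiom3, of x y z] axioms.timeout_seq[THEN rep_axiom3, of x y z]
    axioms.timeout_delay[THEN rep_axiom3, of x y z]
  by (simp_all add: rep_hom)

lemma
  assumes "a \<in> actions A"
  shows lm_const: "cst a \<lfloor> x = cst a \<odot> x"
    and lm_prefix: "cst a \<odot> x \<lfloor> y = cst a \<odot> (x \<parallel> y)"
    and tmo_const: "tmo (cst a) = cst a"
  using axioms.lmerge_const[OF assms, THEN rep_axiom3, of x y x]
    axioms.lmerge_prefix[OF assms, THEN rep_axiom3, of x y x]
    axioms.timeout_const[OF assms, THEN rep_axiom3, of x x x]
  by (simp_all add: rep_hom)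

lemma
  assumes "a \<in> actions A" and "b \<in> actions A"
  shows cm_const: "cst a \<bowtie> cst b = cst (\<gamma> a b)"
    and cm_prefix_const: "cst a \<odot> x \<bowtie> cst b = cst (\<gamma> a b) \<odot> x"
    and cm_const_prefix: "cst a \<bowtie> cst b \<odot> x = cst (\<gamma> a b) \<odot> x"
    and cm_prefix_prefix: "cst a \<odot> x \<bowtie> cst b \<odot> y = cst (\<gamma> a b) \<odot> (x \<parallel> y)"
proof -
  show 1: "cst a \<bowtie> cst b = cst (\<gamma> a b)"
    using axioms.cmerge_const[where \<gamma> = \<gamma>, OF assms comm_closed[OF assms] HOL.refl, THEN rep_axiom3, of x x x]
    by (simp add: rep_hom)
  show "cst a \<odot> x \<bowtie> cst b = cst (\<gamma> a b) \<odot> x" "cst a \<bowtie> cst b \<odot> x = cst (\<gamma> a b) \<odot> x"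
    "cst a \<odot> x \<bowtie> cst b \<odot> y = cst (\<gamma> a b) \<odot> (x \<parallel> y)"
    using axioms.cmerge_prefix_const[OF assms, THEN rep_axiom3, of x y x]
      axioms.cmerge_const_prefix[OF assms, THEN rep_axiom3, of x y x]
      axioms.cmerge_prefix_prefix[OF assms, THEN rep_axiom3, of x y x]
    by (simp_all add: rep_hom 1)
qed

lemma
  assumes "H \<subseteq> A"
  shows enc_const: "a \<in> actions A \<Longrightarrow> enc H (cst a) = cst (if a \<in> Act ` H then Delta else a)"
    and enc_alt: "enc H (x \<oplus> y) = enc H x \<oplus> enc H y"
    and enc_seq: "enc H (x \<odot> y) = enc H x \<odot> enc H y"
    and enc_delay: "enc H (dly x) = dly (enc H x)"
    and hid_const: "a \<in> actions A \<Longrightarrow> hid H (cst a) = cst (if a \<in> Act ` H then Tau else a)"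
    and hid_alt: "hid H (x \<oplus> y) = hid H x \<oplus> hid H y"
    and hid_seq: "hid H (x \<odot> y) = hid H x \<odot> hid H y"
    and hid_delay: "hid H (dly x) = dly (hid H x)"
  using axioms.encap_notin[OF _ assms, THEN rep_axiom3, of a x y x]
    axioms.encap_in[OF _ assms, THEN rep_axiom3, of a x y x]
    axioms.encap_alt[OF assms, THEN rep_axiom3, of x y x]
    axioms.encap_seq[OF assms, THEN rep_axiom3, of x y x]
    axioms.encap_delay[OF assms, THEN rep_axiom3, of x y x]
    axioms.hide_notin[OF _ assms, THEN rep_axiom3, of a x y x]
    axioms.hide_in[OF _ assms, THEN rep_axiom3, of a x y x]
    axioms.hide_alt[OF assms, THEN rep_axiom3, of x y x]
    axioms.hide_seq[OF assms, THEN rep_axiom3, of x y x]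
    axioms.hide_delay[OF assms, THEN rep_axiom3, of x y x]
  by (simp_all add: rep_hom)

lemma delta_alt [simp]: "dd \<oplus> x = rep x"
  by (subst alt_comm) simp

lemma alt_left_comm: "x \<oplus> (y \<oplus> z) = y \<oplus> (x \<oplus> z)"
  by (metis alt_assoc alt_comm)

lemma alt_left_idem: "x \<oplus> (x \<oplus> y) = x \<oplus> y"
  by (metis alt_assoc alt_idem op_rep(1))

lemmas alt_ac = alt_assoc alt_comm alt_left_comm alt_left_idem

lemma delta_lm [simp]: "dd \<lfloor> x = dd"
  by (simp add: lm_const)

lemma tmo_delta [simp]: "tmo dd = dd"
  by (simp add: tmo_const)

lemma comm_Delta_simps [simp]:
  "a \<in> actions A \<Longrightarrow> \<gamma> Delta a = Delta" "a \<in> actions A \<Longrightarrow> \<gamma> a Delta = Delta"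
  using comm_Delta comm_commute[of a Delta] by simp_all

text \<open>Constants and prefixes are fixed by \<open>tmo\<close>, so the axioms that annihilate a
  time-out against a delay apply to them.\<close>

lemma
  assumes "a \<in> actions A"
  shows cm_const_delay: "cst a \<bowtie> dly x = dd" "cst a \<odot> y \<bowtie> dly x = dd"
    and cm_delay_const: "dly x \<bowtie> cst a = dd" "dly x \<bowtie> cst a \<odot> y = dd"
  using cm_timeout_delay[of "cst a"] cm_timeout_delay[of "cst a \<odot> y"]
    cm_delay_timeout[of x "cst a"] cm_delay_timeout[of x "cst a \<odot> y"] assms
  by (simp_all add: tmo_const tmo_seq)

lemma cm_delta_delay [simp]: "dd \<bowtie> dly x = dd" "dly x \<bowtie> dd = dd"
  by (simp_all add: cm_const_delay cm_delay_const)

lemma lm_delay_timeout': "tmo y = y \<Longrightarrow> dly x \<lfloor> y = dd"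
  by (metis lm_delay_timeout)

text \<open>Suited to basic right operands: \<open>basic_timeout_split\<close> yields an equation
  for \<open>y\<close> rather than a visible sum.\<close>

lemma lm_delay_delay': "y = tmo y \<oplus> dly y' \<Longrightarrow> dly x \<lfloor> y = dly (x \<lfloor> y')"
  by (metis lm_delay_delay)

section \<open>Basic terms\<close>

text \<open>The index bounds the nesting of prefixes and delays from above instead of measuring it
  exactly, so both summands of a sum can share one index.\<close>

inductive basic :: "nat \<Rightarrow> 'a tm \<Rightarrow> bool" where
  const: "a \<in> actions A \<Longrightarrow> basic n (cst a)"
| prefix: "a \<in> actions A \<Longrightarrow> basic n p \<Longrightarrow> basic (Suc n) (cst a \<odot> p)"
| alt: "basic n p \<Longrightarrow> basic n q \<Longrightarrow> basic n (p \<oplus> q)"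
| delay: "basic n p \<Longrightarrow> basic (Suc n) (dly p)"

lemma basic_mono: "basic n p \<Longrightarrow> n \<le> m \<Longrightarrow> basic m p"
proof (induction arbitrary: m rule: basic.induct)
  case (prefix a n p)
  then show ?case by (cases m) (auto intro: basic.intros)
next
  case (delay n p)
  then show ?case by (cases m) (auto intro: basic.intros)
qed (auto intro: basic.intros)

text \<open>Keeps the bound \<open>n\<close> fixed: only sums yield induction hypotheses. In the
  merge lemmas, the bodies of prefixes and delays are left to an outer induction on the sum of the
  bounds.\<close>

lemma basic_induct_fixed [consumes 1, case_names const prefix alt delay]:
  assumes "basic n x"
    and "\<And>a. a \<in> actions A \<Longrightarrow> P (cst a)"
    and "\<And>m a p. n = Suc m \<Longrightarrow> a \<in> actions A \<Longrightarrow> basic m p \<Longrightarrow> P (cst a \<odot> p)"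
    and "\<And>p q. basic n p \<Longrightarrow> basic n q \<Longrightarrow> P p \<Longrightarrow> P q \<Longrightarrow> P (p \<oplus> q)"
    and "\<And>m p. n = Suc m \<Longrightarrow> basic m p \<Longrightarrow> P (dly p)"
  shows "P x"
  using assms by (induction n x rule: basic.induct) blast+

text \<open>Constants and prefixes are fixed by \<open>tmo\<close>, and all delayed summands merge
  into one by \<open>delay_alt\<close>. The left merge axioms for a delay on the left need the right
  operand in one of these two shapes.\<close>

lemma basic_timeout_split:
  assumes "basic n y"
  obtains "tmo y = y"
  | m y' where "n = Suc m" "basic m y'" "y = tmo y \<oplus> dly y'"
proof -
  have "tmo y = y \<or> (\<exists>m y'. n = Suc m \<and> basic m y' \<and> y = tmo y \<oplus> dly y')"
    using assms
  proof (induction rule: basic_induct_fixed)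
    case (alt p q)
    from alt.IH show ?case
    proof (elim disjE exE conjE)
      fix m p' m' q'
      assume n: "n = Suc m" "n = Suc m'" and "basic m p'" "basic m' q'"
        and p: "p = tmo p \<oplus> dly p'" and q: "q = tmo q \<oplus> dly q'"
      then have "basic m (p' \<oplus> q')" by (simp add: basic.alt)
      moreover have "p \<oplus> q = tmo (p \<oplus> q) \<oplus> dly (p' \<oplus> q')"
        by (subst p, subst q) (simp add: tmo_alt delay_alt[symmetric] alt_ac)
      ultimately show ?thesis using n by blast
    next
      fix m p'
      assume n: "n = Suc m" "basic m p'" and p: "p = tmo p \<oplus> dly p'" and q: "tmo q = q"
      have "p \<oplus> q = tmo (p \<oplus> q) \<oplus> dly p'"
        by (subst p) (simp add: tmo_alt q alt_ac)
      with n show ?thesis by blast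
    next
      fix m q'
      assume n: "n = Suc m" "basic m q'" and p: "tmo p = p" and q: "q = tmo q \<oplus> dly q'"
      have "p \<oplus> q = tmo (p \<oplus> q) \<oplus> dly q'"
        by (subst q) (simp add: tmo_alt p alt_ac)
      with n show ?thesis by blast
    qed (simp add: tmo_alt)
  next
    case (delay m p)
    then show ?case by (auto simp: tmo_delay)
  qed (simp_all add: tmo_const tmo_seq)
  with that show thesis by blast
qed

section \<open>Closure of the basic terms under all operators\<close>

definition is_basic :: "'a tm \<Rightarrow> bool" where
  "is_basic x \<longleftrightarrow> (\<exists>n. basic n x)"

lemma is_basic_induct [consumes 1, case_names const prefix alt delay]:
  assumes "is_basic x"
    and "\<And>a. a \<in> actions A \<Longrightarrow> P (cst a)"
    and "\<And>a p. a \<in> actions A \<Longrightarrow> is_basic p \<Longrightarrow> P p \<Longrightarrow> P (cst a \<odot> p)"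
    and "\<And>p q. is_basic p \<Longrightarrow> is_basic q \<Longrightarrow> P p \<Longrightarrow> P q \<Longrightarrow> P (p \<oplus> q)"
    and "\<And>p. is_basic p \<Longrightarrow> P p \<Longrightarrow> P (dly p)"
  shows "P x"
proof -
  from assms(1) obtain n where "basic n x" by (auto simp: is_basic_def)
  then show ?thesis
    by (induction rule: basic.induct) (blast intro: assms(2-) is_basic_def[THEN iffD2])+
qed

lemma is_basicI: "basic n x \<Longrightarrow> is_basic x"
  by (auto simp: is_basic_def)

lemma is_basic_const: "a \<in> actions A \<Longrightarrow> is_basic (cst a)"
  and is_basic_prefix: "a \<in> actions A \<Longrightarrow> is_basic p \<Longrightarrow> is_basic (cst a \<odot> p)"
  and is_basic_delay: "is_basic p \<Longrightarrow> is_basic (dly p)"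
  by (auto simp: is_basic_def intro: basic.intros)

lemma is_basic_alt: "is_basic p \<Longrightarrow> is_basic q \<Longrightarrow> is_basic (p \<oplus> q)"
proof -
  assume "is_basic p" "is_basic q"
  then obtain m n where "basic m p" "basic n q" by (auto simp: is_basic_def)
  then have "basic (max m n) p" "basic (max m n) q" by (auto elim: basic_mono)
  then show ?thesis by (auto simp: is_basic_def intro: basic.alt)
qed

lemmas is_basic_intros = is_basic_const is_basic_prefix is_basic_alt is_basic_delay

lemma is_basic_seq: "is_basic x \<Longrightarrow> is_basic y \<Longrightarrow> is_basic (x \<odot> y)"
  by (induction rule: is_basic_induct)
    (simp_all add: is_basic_intros seq_assoc seq_distrib delay_seq)

lemma is_basic_enc: "is_basic x \<Longrightarrow> H \<subseteq> A \<Longrightarrow> is_basic (enc H x)"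
  by (induction rule: is_basic_induct)
    (simp_all add: is_basic_intros is_basic_seq enc_const enc_alt enc_seq enc_delay)

lemma is_basic_hid: "is_basic x \<Longrightarrow> H \<subseteq> A \<Longrightarrow> is_basic (hid H x)"
  by (induction rule: is_basic_induct)
    (simp_all add: is_basic_intros is_basic_seq hid_const hid_alt hid_seq hid_delay)

lemma is_basic_tmo: "is_basic x \<Longrightarrow> is_basic (tmo x)"
  by (induction rule: is_basic_induct)
    (simp_all add: is_basic_intros tmo_const tmo_alt tmo_seq tmo_delay)

text \<open>The three merges are treated together because stepping through a prefix turns a left or
  communication merge into a parallel composition. Each such step lowers the sum of the bounds;
  \<open>par_expand\<close> then settles \<open>\<parallel>\<close> for the same sum.\<close>

lemma is_basic_merge:
  "basic k x \<Longrightarrow> basic l y \<Longrightarrow> is_basic (x \<lfloor> y) \<and> is_basic (x \<bowtie> y) \<and> is_basic (x \<parallel> y)"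
proof (induction "k + l" arbitrary: k l x y rule: less_induct)
  case less
  \<comment> \<open>Generalised over all operands with this sum of bounds, since
    \<open>par_expand\<close> also asks for the left merge with the operands exchanged.\<close>
  have lm: "is_basic (x \<lfloor> y)" if "basic m x" "basic n y" "m + n = k + l" for m n x y
    using that(1)
  proof (induction rule: basic_induct_fixed)
    case (prefix i a p)
    then have "is_basic (p \<parallel> y)" using less.hyps[of i n p y] that by simp
    with prefix show ?case by (simp add: lm_prefix is_basic_intros)
  next
    case (delay i p)
    from \<open>basic n y\<close> show ?case
    proof (cases rule: basic_timeout_split)
      case 1
      then show ?thesis by (simp add: lm_delay_timeout' is_basic_intros)
    next
      case (2 j y')
      then have "is_basic (p \<lfloor> y')" using less.hyps[of i j p y'] delay that by simp
      with 2(3) show ?thesis by (simp add: lm_delay_delay' is_basic_intros)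
    qed
  qed (use is_basicI[OF that(2)] in \<open>simp_all add: lm_const lm_alt is_basic_intros\<close>)
  have cm: "is_basic (x \<bowtie> y)"
    using less.prems(1)
  proof (induction rule: basic_induct_fixed)
    case const
    from less.prems(2) const show ?case
      by (induction rule: basic_induct_fixed)
        (auto simp: cm_const cm_const_prefix cm_alt_right cm_const_delay is_basic_intros
          dest: is_basicI)
  next
    case (prefix i a p)
    from less.prems(2) show ?case
    proof (induction rule: basic_induct_fixed)
      case (prefix j b q)
      then have "is_basic (p \<parallel> q)" using less.hyps[of i j p q] \<open>k = Suc i\<close> \<open>basic i p\<close> by simp
      with prefix \<open>a \<in> actions A\<close> show ?case by (simp add: cm_prefix_prefix is_basic_intros)
    qed (use prefix is_basicI in
        \<open>auto simp: cm_prefix_const cm_alt_right cm_const_delay is_basic_intros\<close>)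
  next
    case (alt p q)
    then show ?case by (simp add: cm_alt_left is_basic_intros)
  next
    case (delay i p)
    from less.prems(2) show ?case
    proof (induction rule: basic_induct_fixed)
      case (delay j q)
      then have "is_basic (p \<bowtie> q)" using less.hyps[of i j p q] \<open>k = Suc i\<close> \<open>basic i p\<close> by simp
      then show ?case by (simp add: cm_delay_delay is_basic_intros)
    qed (simp_all add: cm_delay_const cm_alt_right is_basic_intros)
  qed
  have "is_basic (x \<lfloor> y)" "is_basic (y \<lfloor> x)"
    using lm less.prems by (auto simp: add.commute)
  with cm show ?case by (simp add: par_expand is_basic_alt)
qed

lemma is_basic_lm: "is_basic x \<Longrightarrow> is_basic y \<Longrightarrow> is_basic (x \<lfloor> y)"
  and is_basic_cm: "is_basic x \<Longrightarrow> is_basic y \<Longrightarrow> is_basic (x \<bowtie> y)"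
  and is_basic_par: "is_basic x \<Longrightarrow> is_basic y \<Longrightarrow> is_basic (x \<parallel> y)"
  using is_basic_merge by (auto simp: is_basic_def[of x] is_basic_def[of y])

text \<open>The elimination theorem: \<open>rep_hom\<close> pushes \<open>rep\<close> to the leaves
  and each operator preserves basic terms; closedness excludes variables.\<close>

lemma is_basic_rep: "closed_term A t \<Longrightarrow> is_basic (rep t)"
  unfolding closed_term_def
  by (induction t)
    (simp_all only: rep_hom wf_term.simps vars.simps Un_empty insert_not_empty is_basic_const
      is_basic_alt is_basic_seq is_basic_lm is_basic_cm is_basic_par is_basic_delay is_basic_enc
      is_basic_hid is_basic_tmo simp_thms)

section \<open>Commutativity\<close>

text \<open>Two communicating prefixes leave a parallel composition and two delays a communication
  merge, each with a smaller sum of bounds. The expansion of \<open>\<parallel>\<close> is symmetric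
  once \<open>\<bowtie>\<close> commutes.\<close>

lemma merge_commute:
  "basic k x \<Longrightarrow> basic l y \<Longrightarrow> x \<bowtie> y = y \<bowtie> x \<and> x \<parallel> y = y \<parallel> x"
proof (induction "k + l" arbitrary: k l x y rule: less_induct)
  case less
  have "x \<bowtie> y = y \<bowtie> x"
    using less.prems(1)
  proof (induction rule: basic_induct_fixed)
    case const
    from less.prems(2) const show ?case
      by (induction rule: basic_induct_fixed)
        (simp_all add: cm_const cm_const_prefix cm_prefix_const cm_alt_right cm_alt_left
          cm_const_delay cm_delay_const comm_commute)
  next
    case (prefix i a p)
    from less.prems(2) show ?case
    proof (induction rule: basic_induct_fixed)
      case (prefix j b q)
      then have "p \<parallel> q = q \<parallel> p" using less.hyps[of i j p q] \<open>k = Suc i\<close> \<open>basic i p\<close> by simp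
      with prefix \<open>a \<in> actions A\<close> show ?case
        by (simp add: cm_prefix_prefix comm_commute[of a b])
    qed (use prefix in \<open>simp_all add: cm_const_prefix cm_prefix_const cm_alt_right cm_alt_left
          cm_const_delay cm_delay_const comm_commute\<close>)
  next
    case (alt p q)
    then show ?case by (simp add: cm_alt_left cm_alt_right)
  next
    case (delay i p)
    from less.prems(2) show ?case
    proof (induction rule: basic_induct_fixed)
      case (delay j q)
      then have "p \<bowtie> q = q \<bowtie> p" using less.hyps[of i j p q] \<open>k = Suc i\<close> \<open>basic i p\<close> by simp
      then show ?case by (simp add: cm_delay_delay)
    qed (simp_all add: cm_delay_const cm_const_delay cm_alt_right cm_alt_left)
  qed
  then show ?case by (simp add: par_expand alt_ac)
qed

lemma cm_commute: "is_basic x \<Longrightarrow> is_basic y \<Longrightarrow> x \<bowtie> y = y \<bowtie> x"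
  and par_commute: "is_basic x \<Longrightarrow> is_basic y \<Longrightarrow> x \<parallel> y = y \<parallel> x"
  using merge_commute by (auto simp: is_basic_def)

section \<open>Time-out of merges\<close>

lemma is_basic_timeout_split:
  assumes "is_basic y"
  obtains "tmo y = y" | y' where "is_basic y'" "y = tmo y \<oplus> dly y'"
  using assms basic_timeout_split unfolding is_basic_def by metis

text \<open>A delay on the left gives \<open>dd\<close> or a delay for either shape of
  \<open>y\<close>, and \<open>tmo\<close> sends both to \<open>dd\<close>. Time-out falls on the
  left operand alone, which performs the first step.\<close>

lemma tmo_lm: "is_basic x \<Longrightarrow> is_basic y \<Longrightarrow> tmo (x \<lfloor> y) = tmo x \<lfloor> y"
proof (induction rule: is_basic_induct)
  case (delay p)
  from \<open>is_basic y\<close> show ?case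
    by (cases rule: is_basic_timeout_split)
      (simp_all add: lm_delay_timeout' lm_delay_delay' tmo_delay)
qed (simp_all add: lm_const lm_prefix lm_alt tmo_const tmo_seq tmo_alt)

text \<open>Both operands take part in the first step, so time-out reaches both. Pairing a delay
  with a constant or a prefix gives \<open>dd\<close> on either side.\<close>

lemma tmo_cm: "is_basic x \<Longrightarrow> is_basic y \<Longrightarrow> tmo (x \<bowtie> y) = tmo x \<bowtie> tmo y"
proof (induction rule: is_basic_induct)
  case (const a)
  from const(2,1) show ?case
    by (induction rule: is_basic_induct)
      (simp_all add: cm_const cm_const_prefix cm_alt_right cm_const_delay tmo_const tmo_seq tmo_alt
        tmo_delay)
next
  case (prefix a p)
  from prefix(4,1) show ?case
    by (induction rule: is_basic_induct)
      (simp_all add: cm_prefix_const cm_prefix_prefix cm_alt_right cm_const_delay tmo_const tmo_seq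
        tmo_alt tmo_delay)
next
  case (alt p q)
  then show ?case by (simp add: cm_alt_left tmo_alt)
next
  case (delay p)
  from delay(3) show ?case
    by (induction rule: is_basic_induct)
      (simp_all add: cm_delay_const cm_delay_delay cm_alt_right tmo_const tmo_seq
        tmo_alt tmo_delay cm_const cm_const_prefix)
qed

lemma cm_tmo_left: "is_basic y \<Longrightarrow> tmo x \<bowtie> y = tmo x \<bowtie> tmo y"
  by (erule is_basic_timeout_split) (simp, metis alt_delta cm_alt_right cm_timeout_delay rep_op(6))

lemma tmo_par: "is_basic x \<Longrightarrow> is_basic y \<Longrightarrow>
    tmo (x \<parallel> y) = tmo x \<lfloor> y \<oplus> tmo y \<lfloor> x \<oplus> tmo x \<bowtie> tmo y"
  by (simp add: par_expand tmo_alt tmo_lm tmo_cm)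

text \<open>Without a delayed part in \<open>y\<close>, the delayed summand of \<open>x\<close>
  contributes only \<open>dd\<close>.\<close>

lemma lm_timeout: "tmo y = y \<Longrightarrow> is_basic x \<Longrightarrow> x \<lfloor> y = tmo x \<lfloor> y"
proof (erule is_basic_timeout_split)
  fix x' assume y: "tmo y = y" and x: "x = tmo x \<oplus> dly x'"
  have "(tmo x \<oplus> dly x') \<lfloor> y = tmo x \<lfloor> y"
    by (simp add: lm_alt lm_delay_timeout'[OF y])
  then show ?thesis by (simp only: x[symmetric])
qed simp

text \<open>With \<open>x\<close> confined to the current slice, \<open>lm_timeout\<close> removes
  the delayed part of \<open>y\<close> from \<open>y \<lfloor> x\<close> and
  \<open>cm_tmo_left\<close> removes it from \<open>x \<bowtie> y\<close>.\<close>

lemma tmo_par_timeout: "tmo x = x \<Longrightarrow> is_basic x \<Longrightarrow> is_basic y \<Longrightarrow> tmo (x \<parallel> y) = x \<parallel> y"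
  using cm_tmo_left[of y x] lm_timeout[of x y] by (simp add: tmo_par) (simp add: par_expand)

text \<open>Both components enter the next slice together, each of the three summands of
  \<open>par_expand\<close> contributing one delayed part. This gives \<open>y \<parallel> z\<close>
  the shape that the delay axiom for left merge needs on its right.\<close>

lemma par_split:
  assumes x: "x = tmo x \<oplus> dly x'" and y: "y = tmo y \<oplus> dly y'" and "is_basic x" "is_basic y"
  shows "x \<parallel> y = tmo (x \<parallel> y) \<oplus> dly (x' \<parallel> y')"
proof -
  have "x \<lfloor> y = tmo x \<lfloor> y \<oplus> dly (x' \<lfloor> y')"
    by (metis x y lm_alt lm_delay_delay')
  moreover have "y \<lfloor> x = tmo y \<lfloor> x \<oplus> dly (y' \<lfloor> x')"
    by (metis x y lm_alt lm_delay_delay')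
  moreover have "x \<bowtie> y = tmo x \<bowtie> tmo y \<oplus> dly (x' \<bowtie> y')"
    by (subst x, subst y) (simp add: cm_alt_left cm_alt_right cm_timeout_delay cm_delay_timeout
        cm_delay_delay)
  ultimately show ?thesis
    unfolding tmo_par[OF assms(3,4)] by (simp only: par_expand delay_alt[symmetric] alt_ac)
qed

section \<open>Associativity\<close>

text \<open>Stepping through a prefix calls for associativity of \<open>\<parallel>\<close>,
  stepping through delays for the law under proof, both at a smaller sum.\<close>

lemma merge_assoc:
  "k + l + m = N \<Longrightarrow> basic k x \<Longrightarrow> basic l y \<Longrightarrow> basic m z \<Longrightarrow>
    x \<lfloor> y \<lfloor> z = x \<lfloor> (y \<parallel> z) \<and> x \<bowtie> (y \<lfloor> z) = x \<bowtie> y \<lfloor> z \<and>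
    x \<bowtie> y \<bowtie> z = x \<bowtie> (y \<bowtie> z) \<and> x \<parallel> y \<parallel> z = x \<parallel> (y \<parallel> z)"
proof (induction N arbitrary: k l m x y z rule: less_induct)
  case (less N)
  \<comment> \<open>Stated for all operands with sum \<open>N\<close>, since the final expansion
    uses this law for permuted operands; likewise \<open>cl\<close> below.\<close>
  have lm: "x \<lfloor> y \<lfloor> z = x \<lfloor> (y \<parallel> z)"
    if "k + l + m = N" "basic k x" "basic l y" "basic m z" for k l m x y z
    using that(2)
  proof (induction rule: basic_induct_fixed)
    case (prefix i a p)
    then have "p \<parallel> y \<parallel> z = p \<parallel> (y \<parallel> z)"
      using less.IH[of "i + l + m" i l m p y z] that by simp
    with prefix show ?case by (simp add: lm_prefix)
  next
    case (delay i p)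
    from \<open>basic l y\<close> show ?case
    proof (cases rule: basic_timeout_split)
      \<comment> \<open>Both sides are \<open>dd\<close>: \<open>y\<close> stays in the current
        slice, and so does \<open>y \<parallel> z\<close>.\<close>
      case 1
      moreover from 1 have "tmo (y \<parallel> z) = y \<parallel> z"
        using that is_basicI tmo_par_timeout by blast
      ultimately show ?thesis by (simp add: lm_delay_timeout')
    next
      case y: (2 l' y')
      from \<open>basic m z\<close> show ?thesis
      proof (cases rule: basic_timeout_split)
        \<comment> \<open>Again both sides are \<open>dd\<close>; commutativity transfers the
          argument from \<open>y\<close> to \<open>z\<close>.\<close>
        case 1
        then have "tmo (y \<parallel> z) = y \<parallel> z"
          using that is_basicI tmo_par_timeout par_commute by metis
        with 1 show ?thesis by (simp add: lm_delay_timeout' lm_delay_delay'[OF y(3)])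
      next
        case z: (2 m' z')
        have "y \<parallel> z = tmo (y \<parallel> z) \<oplus> dly (y' \<parallel> z')"
          using par_split[OF y(3) z(3)] that is_basicI by blast
        moreover have "p \<lfloor> y' \<lfloor> z' = p \<lfloor> (y' \<parallel> z')"
          using less.IH[of "i + l' + m'" i l' m' p y' z'] delay y z that by simp
        ultimately show ?thesis
          by (simp add: lm_delay_delay'[OF y(3)] lm_delay_delay'[OF z(3)] lm_delay_delay')
      qed
    qed
  qed (simp_all add: lm_const lm_prefix lm_alt)
  have cl: "x \<bowtie> (y \<lfloor> z) = x \<bowtie> y \<lfloor> z"
    if "k + l + m = N" "basic k x" "basic l y" "basic m z" for k l m x y z
  proof -
    \<comment> \<open>Whichever shape \<open>z\<close> has, \<open>dly q \<lfloor> z\<close> is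
      \<open>dd\<close> or a delay.\<close>
    have dl: "u \<bowtie> (dly q \<lfloor> z) = dd" if "\<And>v. u \<bowtie> dly v = dd" "u \<bowtie> dd = dd" for u q
      using \<open>basic m z\<close>
      by (cases rule: basic_timeout_split) (simp_all add: lm_delay_timeout' lm_delay_delay' that)
    from that(2) show ?thesis
    proof (induction rule: basic_induct_fixed)
      case (const a)
      from \<open>basic l y\<close> const show ?case
        by (induction rule: basic_induct_fixed)
          (simp_all add: cm_const cm_const_prefix cm_alt_right lm_const lm_prefix lm_alt
            cm_const_delay dl)
    next
      case (prefix i a p)
      from \<open>basic l y\<close> show ?case
      proof (induction rule: basic_induct_fixed)
        case (prefix j b q)
        then have "p \<parallel> q \<parallel> z = p \<parallel> (q \<parallel> z)"
          using less.IH[of "i + j + m" i j m p q z] \<open>k = Suc i\<close> \<open>basic i p\<close> that by simp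
        with prefix \<open>a \<in> actions A\<close> show ?case by (simp add: cm_prefix_prefix lm_prefix)
      qed (use prefix in \<open>simp_all add: cm_prefix_const cm_prefix_prefix cm_alt_right lm_const
            lm_prefix lm_alt cm_const_delay dl\<close>)
    next
      case (alt p q)
      then show ?case by (simp add: cm_alt_left lm_alt)
    next
      case (delay i p)
      from \<open>basic l y\<close> show ?case
      proof (induction rule: basic_induct_fixed)
        case (delay j q)
        from \<open>basic m z\<close> show ?case
        proof (cases rule: basic_timeout_split)
          case 1
          then show ?thesis by (simp add: lm_delay_timeout' cm_delay_delay)
        next
          case (2 m' z')
          then have "p \<bowtie> (q \<lfloor> z') = p \<bowtie> q \<lfloor> z'"
            using less.IH[of "i + j + m'" i j m' p q z'] delay \<open>k = Suc i\<close> \<open>basic i p\<close> that by simp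
          then show ?thesis by (simp add: lm_delay_delay'[OF 2(3)] cm_delay_delay)
        qed
      qed (simp_all add: cm_delay_const cm_alt_right lm_const lm_prefix lm_alt)
    qed
  qed
  \<comment> \<open>Only three prefixes and three delays consult the outer induction hypothesis. A
    delay mixed with a constant or a prefix gives \<open>dd\<close> on both sides, sums distribute,
    and combinations of constants and prefixes rest on \<open>comm_assoc\<close>.\<close>
  have cm: "x \<bowtie> y \<bowtie> z = x \<bowtie> (y \<bowtie> z)"
    using less.prems(2)
  proof (induction rule: basic_induct_fixed)
    case (const a)
    from less.prems(3) show ?case
    proof (induction rule: basic_induct_fixed)
      case (const b)
      from less.prems(4) const \<open>a \<in> actions A\<close> show ?case
        by (induction rule: basic_induct_fixed)
          (simp_all add: cm_const cm_const_prefix cm_alt_right cm_const_delay comm_assoc)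
    next
      case (prefix j b q)
      from less.prems(4) prefix(2) \<open>a \<in> actions A\<close> show ?case
        by (induction rule: basic_induct_fixed)
          (simp_all add: cm_prefix_const cm_const_prefix cm_prefix_prefix cm_alt_right
            cm_const_delay cm_const comm_assoc)
    next
      case (alt p q)
      then show ?case by (simp add: cm_alt_left cm_alt_right)
    next
      case (delay j q)
      from less.prems(4) \<open>a \<in> actions A\<close> show ?case
        by (induction rule: basic_induct_fixed)
          (simp_all add: cm_const_delay cm_delay_const cm_delay_delay cm_alt_right cm_const
            cm_const_prefix)
    qed
  next
    case (prefix i a p)
    note a = \<open>a \<in> actions A\<close>
    from less.prems(3) show ?case
    proof (induction rule: basic_induct_fixed)
      case (const b)
      from less.prems(4) const a show ?case
        by (induction rule: basic_induct_fixed)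
          (simp_all add: cm_const cm_prefix_const cm_const_prefix cm_prefix_prefix cm_alt_right
            cm_const_delay comm_assoc)
    next
      case (prefix j b q)
      note b = \<open>b \<in> actions A\<close>
      from less.prems(4) show ?case
      proof (induction rule: basic_induct_fixed)
        case (prefix n c r)
        then have "p \<parallel> q \<parallel> r = p \<parallel> (q \<parallel> r)"
          using less.IH[of "i + j + n" i j n p q r] \<open>k = Suc i\<close> \<open>basic i p\<close> \<open>l = Suc j\<close> \<open>basic j q\<close>
            less.prems(1) by simp
        with a b prefix show ?case by (simp add: cm_prefix_prefix comm_assoc)
      qed (use a b in \<open>simp_all add: cm_prefix_const cm_prefix_prefix cm_alt_right cm_const_delay
            comm_assoc\<close>)
    next
      case (alt p q)
      then show ?case by (simp add: cm_alt_left cm_alt_right)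
    next
      case (delay j q)
      from less.prems(4) a show ?case
        by (induction rule: basic_induct_fixed)
          (simp_all add: cm_const_delay cm_delay_const cm_delay_delay cm_alt_right cm_const
            cm_const_prefix cm_prefix_const)
    qed
  next
    case (alt p q)
    then show ?case by (simp add: cm_alt_left)
  next
    case (delay i p)
    from less.prems(3) show ?case
    proof (induction rule: basic_induct_fixed)
      case (const b)
      from less.prems(4) const show ?case
        by (induction rule: basic_induct_fixed)
          (simp_all add: cm_const cm_const_prefix cm_alt_right cm_const_delay cm_delay_const)
    next
      case (prefix j b q)
      from less.prems(4) prefix(2) show ?case
        by (induction rule: basic_induct_fixed)
          (simp_all add: cm_const cm_const_prefix cm_prefix_const cm_prefix_prefix cm_alt_right
            cm_const_delay cm_delay_const)
    next
      case (alt p q)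
      then show ?case by (simp add: cm_alt_left cm_alt_right)
    next
      case (delay j q)
      from less.prems(4) show ?case
      proof (induction rule: basic_induct_fixed)
        case (delay n r)
        then have "p \<bowtie> q \<bowtie> r = p \<bowtie> (q \<bowtie> r)"
          using less.IH[of "i + j + n" i j n p q r] \<open>k = Suc i\<close> \<open>basic i p\<close> \<open>l = Suc j\<close> \<open>basic j q\<close>
            less.prems(1) by simp
        then show ?case by (simp add: cm_delay_delay)
      qed (simp_all add: cm_delay_delay cm_alt_right cm_delay_const)
    qed
  qed
  have B: "is_basic x" "is_basic y" "is_basic z"
    using less.prems is_basicI by blast+
  \<comment> \<open>Each bracketing of the triple composition expands to seven summands. The four
    facts from here on, with \<open>lm\<close>, \<open>cl\<close> and \<open>cm\<close> for the
    given order, pair them off.\<close>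
  have "y \<lfloor> x \<lfloor> z = y \<lfloor> z \<lfloor> x"
    using lm[of l k m y x z] lm[of l m k y z x] par_commute[OF B(1,3)] less.prems
    by (simp add: ac_simps)
  moreover have "z \<lfloor> (x \<parallel> y) = z \<lfloor> y \<lfloor> x"
    using lm[of m l k z y x] par_commute[OF B(1,2)] less.prems by (simp add: ac_simps)
  \<comment> \<open>Commuting \<open>z\<close> to the front makes \<open>cl\<close> applicable in
    the order \<open>z\<close>, \<open>x\<close>, \<open>y\<close>; commuting
    \<open>z \<bowtie> x\<close> then allows \<open>cl\<close> backwards in the order
    \<open>x\<close>, \<open>z\<close>, \<open>y\<close>.\<close>
  moreover have "x \<lfloor> y \<bowtie> z = x \<bowtie> (z \<lfloor> y)"
    using cl[of m k l z x y] cl[of k m l x z y] cm_commute[OF B(1,3)] B less.prems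
    by (simp add: ac_simps cm_commute[of "x \<lfloor> y" z] is_basic_lm)
  moreover have "y \<lfloor> x \<bowtie> z = y \<bowtie> z \<lfloor> x"
    using cl[of m l k z y x] cm_commute[OF B(2,3)] B less.prems
    by (simp add: ac_simps cm_commute[of "y \<lfloor> x" z] is_basic_lm)
  ultimately have "x \<parallel> y \<parallel> z = x \<parallel> (y \<parallel> z)"
    using lm[of k l m x y z] cl[of k l m x y z] cm less.prems
    unfolding par_expand[of "x \<parallel> y" z] par_expand[of x "y \<parallel> z"]
    unfolding par_expand[of x y] par_expand[of y z]
    by (simp add: lm_alt cm_alt_left cm_alt_right alt_ac par_expand[of x y, symmetric])
  with lm[OF less.prems] cl[OF less.prems] cm show ?case by blast
qed

lemma
  assumes "is_basic x" "is_basic y" "is_basic z"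
  shows lm_assoc: "x \<lfloor> y \<lfloor> z = x \<lfloor> (y \<parallel> z)"
    and cm_lm: "x \<bowtie> (y \<lfloor> z) = x \<bowtie> y \<lfloor> z"
    and cm_assoc: "x \<bowtie> y \<bowtie> z = x \<bowtie> (y \<bowtie> z)"
    and par_assoc: "x \<parallel> y \<parallel> z = x \<parallel> (y \<parallel> z)"
  using assms merge_assoc[OF HOL.refl] unfolding is_basic_def by blast+

section \<open>Return from representatives to derivability\<close>

lemma standard_concurrency_derivable:
  assumes "(s, t) \<in> standard_concurrency" and "\<And>v. closed_term A (\<rho> v)"
  shows "derivable A \<gamma> (subst \<rho> s) (subst \<rho> t)"
proof (rule rep_eqD)
  \<comment> \<open>The substituted terms are closed, so their representatives are basic and the
    laws above apply to them.\<close>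
  have B: "is_basic (rep (\<rho> v))" for v
    using assms(2) is_basic_rep by blast
  show "rep (subst \<rho> s) = rep (subst \<rho> t)"
    using assms(1) par_commute[OF B B] cm_commute[OF B B] par_assoc[OF B B B] lm_assoc[OF B B B]
      cm_assoc[OF B B B] cm_lm[OF B B B]
    by (auto simp: standard_concurrency_def rep_hom)
  have "wf_term A (\<rho> v)" for v
    using assms(2) by (simp add: closed_term_def)
  then show "wf_term A (subst \<rho> s)" "wf_term A (subst \<rho> t)"
    using assms(1) by (auto simp: standard_concurrency_def)
qed

end

theorem theorem2:
  fixes A :: "'a set" and \<gamma> :: "'a act \<Rightarrow> 'a act \<Rightarrow> 'a act"
  assumes "finite A"
    and "\<And>a b. a \<in> actions A \<Longrightarrow> b \<in> actions A \<Longrightarrow> \<gamma> a b \<in> actions A"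
    and "\<And>a b. a \<in> actions A \<Longrightarrow> b \<in> actions A \<Longrightarrow> \<gamma> a b = \<gamma> b a"
    and "\<And>a b c. a \<in> actions A \<Longrightarrow> b \<in> actions A \<Longrightarrow> c \<in> actions A \<Longrightarrow>
           \<gamma> (\<gamma> a b) c = \<gamma> a (\<gamma> b c)"
    and "\<And>a. a \<in> actions A \<Longrightarrow> \<gamma> Tau a = Delta"
    and "\<And>a. a \<in> actions A \<Longrightarrow> \<gamma> Delta a = Delta"
  shows "\<forall>(s, t) \<in> standard_concurrency. \<forall>\<rho>. (\<forall>v. closed_term A (\<rho> v)) \<longrightarrow>
           derivable A \<gamma> (subst \<rho> s) (subst \<rho> t)"
proof -
  interpret communication A \<gamma>
    by unfold_locales (fact assms)+
  show ?thesis
    using standard_concurrency_derivable by blast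
qed

end
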